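(* Let $\mathcal F$ be a family of error functions. (1) Suppose $\mathbf E$ is an e-collection that does not depend on $\alpha$. Then $(\mathcal R^{\mathrm{ER}_{\mathrm f}}_\alpha(\mathbf E))_{\mathrm f\in\mathcal F,\,\alpha>0}$ guarantees simultaneous control over $\mathcal F$ and $\alpha>0$. (2) Furthermore, for every collection $(\boldsymbol{\mathcal R}^{\mathrm{ER}_{\mathrm f}}_\alpha)_{\mathrm f\in\mathcal F,\,\alpha>0}$ with simultaneous control over $\mathcal F$ and $\alpha>0$, there exists an e-collection $\mathbf E$ (that does not depend on $\alpha$) such that $\boldsymbol{\mathcal R}^{\mathrm{ER}_{\mathrm f}}_\alpha\subseteq\mathcal R^{\mathrm{ER}_{\mathrm f}}_\alpha(\mathbf E)$ for all $\mathrm f\in\mathcal F$ and $\alpha>0$.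
   Context: Setting: $M$ is a set of probability measures on a measurable space; $[m]=\{1,\dots,m\}$; the hypotheses are $H_1,\dots,H_m\subseteq M$; for $\mathrm P\in M$, $N_{\mathrm P}=\{i\in[m]:\mathrm P\in H_i\}$ is the index set of the true hypotheses, and $\mathbb E_{\mathrm P}$ is expectation under $\mathrm P$. Inequalities and inclusions between random objects are understood to hold almost surely. An error function (loss) $\mathrm f$ assigns to each pair $N,R\in 2^{[m]}$ a nonnegative number $\mathrm f_N(R)$, with $\mathrm f_N(\emptyset)=0$ for all $N\in 2^{[m]}$ and $\mathrm f_\emptyset(R)=0$ for all $R\in 2^{[m]}$. An e-collection is a collection $\mathbf E=(\mathbf e_S)_{S\in 2^{[m]}}$ of nonnegative random variables with $\mathbb E_{\mathrm P}(\mathbf e_{N_{\mathrm P}})\le 1$ for all $\mathrm P\in M$; by convention $\mathbf e_\emptyset=0$. That $\mathbf E$ does not depend on $\alpha$ means that the same single family $\mathbf E$ is used for all $\alpha>0$. For $\alpha>0$ and an error function $\mathrm f$, $$\mathcal R^{\mathrm{ER}_{\mathrm f}}_\alpha(\mathbf E)=\Big\{R\in 2^{[m]}:\mathbf e_S\ge\frac{\mathrm f_S(R)}{\alpha}\ \text{for all }S\in 2^{[m]}\Big\}.$$ For every $\alpha>0$ and $\mathrm f\in\mathcal F$, let $\boldsymbol{\mathcal R}^{\mathrm{ER}_{\mathrm f}}_\alpha\subseteq 2^{[m]}$ be a random collection of discovery sets (which may be assumed never empty, since $\emptyset$ can always be added). The family $(\boldsymbol{\mathcal R}^{\mathrm{ER}_{\mathrm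 f}}_\alpha)_{\mathrm f\in\mathcal F,\alpha>0}$ ensures simultaneous control over $\mathcal F$ and nominal levels $\alpha>0$ if, for every $\mathrm P\in M$, $$\mathbb E_{\mathrm P}\Big(\sup_{\alpha>0}\,\sup_{\mathrm f\in\mathcal F}\,\max_{R\in\boldsymbol{\mathcal R}^{\mathrm{ER}_{\mathrm f}}_\alpha}\frac{\mathrm f_{N_{\mathrm P}}(R)}{\alpha}\Big)\le1,$$ with $0/0=0$ and $x/0=\infty$ for positive $x$. For uncountable loss families or level sets, the supremum displayed here is assumed to be measurable. *)

theory Defs
  imports "HOL-Probability.Probability"
begin

definition true_hyps :: "nat \<Rightarrow> (nat \<Rightarrow> 'a measure set) \<Rightarrow> 'a measure \<Rightarrow> nat set" where
  "true_hyps m H P = {i \<in> {1..m}. P \<in> H i}"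

definition error_function :: "nat \<Rightarrow> (nat set \<Rightarrow> nat set \<Rightarrow> real) \<Rightarrow> bool" where
  "error_function m f \<longleftrightarrow>
     (\<forall>N\<in>Pow {1..m}. \<forall>R\<in>Pow {1..m}. 0 \<le> f N R) \<and>
     (\<forall>N\<in>Pow {1..m}. f N {} = 0) \<and>
     (\<forall>R\<in>Pow {1..m}. f {} R = 0)"

text \<open>
  E-values take values in \<open>[0, \<infinity>]\<close>, as is usual. The value \<open>\<infinity>\<close> cannot be excluded: if \<open>S\<close> is not the
  set of true hypotheses of any measure in the model, no expectation bound restricts \<open>E S\<close>.
\<close>

definition e_collection ::
  "'a measure \<Rightarrow> 'a measure set \<Rightarrow> nat \<Rightarrow> (nat \<Rightarrow> 'a measure set) \<Rightarrow> (nat set \<Rightarrow> 'a \<Rightarrow> ennreal) \<Rightarrow> bool" where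
  "e_collection A M m H E \<longleftrightarrow>
     (\<forall>S\<in>Pow {1..m}. E S \<in> borel_measurable A) \<and>
     (\<forall>\<omega>\<in>space A. E {} \<omega> = 0) \<and>
     (\<forall>P\<in>M. (\<integral>\<^sup>+\<omega>. E (true_hyps m H P) \<omega> \<partial>P) \<le> 1)"

definition discovery_sets ::
  "nat \<Rightarrow> (nat set \<Rightarrow> 'a \<Rightarrow> ennreal) \<Rightarrow> (nat set \<Rightarrow> nat set \<Rightarrow> real) \<Rightarrow> real \<Rightarrow> 'a \<Rightarrow> nat set set" where
  "discovery_sets m E f \<alpha> \<omega> =
     {R \<in> Pow {1..m}. \<forall>S\<in>Pow {1..m}. E S \<omega> \<ge> ennreal (f S R / \<alpha>)}"

text \<open>
  The innermost supremum ranges over a finite set of discovery sets, so it is the maximum. If that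
  set is empty, the supremum in \<^typ>\<open>ennreal\<close> is \<open>0\<close>, the same as after adding the discovery set \<open>{}\<close>.
\<close>

definition sup_loss ::
  "(nat set \<Rightarrow> nat set \<Rightarrow> real) set \<Rightarrow> ((nat set \<Rightarrow> nat set \<Rightarrow> real) \<Rightarrow> real \<Rightarrow> 'a \<Rightarrow> nat set set) \<Rightarrow>
     nat set \<Rightarrow> 'a \<Rightarrow> ennreal" where
  "sup_loss F C N \<omega> = (SUP \<alpha>\<in>{0<..}. SUP f\<in>F. SUP R\<in>C f \<alpha> \<omega>. ennreal (f N R / \<alpha>))"

text \<open>
  Measurability of each \<open>C f \<alpha>\<close> says that it is a random collection of subsets of \<open>{1..m}\<close>.
  Measurability of the supremum is part of the notion, since the nonnegative integral is also
  defined for non-measurable functions, where it is not an expectation.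
\<close>

definition simultaneous_control ::
  "'a measure \<Rightarrow> 'a measure set \<Rightarrow> nat \<Rightarrow> (nat \<Rightarrow> 'a measure set) \<Rightarrow>
     (nat set \<Rightarrow> nat set \<Rightarrow> real) set \<Rightarrow>
     ((nat set \<Rightarrow> nat set \<Rightarrow> real) \<Rightarrow> real \<Rightarrow> 'a \<Rightarrow> nat set set) \<Rightarrow> bool" where
  "simultaneous_control A M m H F C \<longleftrightarrow>
     (\<forall>f\<in>F. \<forall>\<alpha>>0. C f \<alpha> \<in> measurable A (count_space (Pow (Pow {1..m})))) \<and>
     (\<forall>P\<in>M. sup_loss F C (true_hyps m H P) \<in> borel_measurable A \<and>
             (\<integral>\<^sup>+\<omega>. sup_loss F C (true_hyps m H P) \<omega> \<partial>P) \<le> 1)"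

end

theory Submission
  imports Defs
begin

text \<open>
  For (1), the discovery sets of \<open>E\<close> are defined so that the largest loss for the index set \<open>N\<close> is at
  most \<open>E N\<close>, whose expectation is at most \<open>1\<close> if \<open>N\<close> is the set of true hypotheses. It remains to
  see that the supremum is measurable although the family of losses may be uncountable: it exceeds
  \<open>c\<close> exactly if the vector \<open>(E S)\<^sub>S\<close> lies in a union of orthants, and since \<open>\<alpha>\<close> can be enlarged
  slightly, orthants with rational corners suffice. For (2), take \<open>E S\<close> to be the supremum of the losses
  if \<open>S\<close> is the set of true hypotheses of some \<open>P\<close>, and \<open>\<infinity>\<close> if no measure in the model constrains \<open>S\<close>.
\<close>

lemma true_hyps_in_Pow: "true_hyps m H P \<in> Pow {1..m}"
  by (auto simp: true_hyps_def)

text \<open>There are only finitely many possible values \<open>D\<close>, so their preimages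
  suffice; each is a finite Boolean combination of events comparing some \<open>E S\<close> with a
  constant.\<close>

lemma measurable_discovery_sets:
  assumes "\<And>S. S \<in> Pow {1..m} \<Longrightarrow> E S \<in> borel_measurable A"
  shows "discovery_sets m E f \<alpha> \<in> measurable A (count_space (Pow (Pow {1..m})))"
proof -
  have "discovery_sets m E f \<alpha> -` {D} \<inter> space A \<in> sets A" if D: "D \<in> Pow (Pow {1..m})" for D
  proof -
    have "discovery_sets m E f \<alpha> \<omega> = D \<longleftrightarrow>
        (\<forall>R\<in>Pow {1..m}. (\<forall>S\<in>Pow {1..m}. ennreal (f S R / \<alpha>) \<le> E S \<omega>) \<longleftrightarrow> R \<in> D)" for \<omega>
      using D unfolding discovery_sets_def by blast
    then have "discovery_sets m E f \<alpha> -` {D} \<inter> space A =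
        {\<omega> \<in> space A. \<forall>R\<in>Pow {1..m}. (\<forall>S\<in>Pow {1..m}. ennreal (f S R / \<alpha>) \<le> E S \<omega>) \<longleftrightarrow> R \<in> D}"
      by blast
    also have "\<dots> \<in> sets A"
      using assms by measurable
    finally show ?thesis .
  qed
  moreover have "discovery_sets m E f \<alpha> \<in> space A \<rightarrow> Pow (Pow {1..m})"
    unfolding discovery_sets_def by blast
  ultimately show ?thesis
    by (simp add: measurable_count_space_eq2)
qed

lemma sup_loss_upper:
  assumes "f \<in> F" "\<alpha> > 0" "R \<in> C f \<alpha> \<omega>"
  shows "ennreal (f N R / \<alpha>) \<le> sup_loss F C N \<omega>"
proof -
  have "ennreal (f N R / \<alpha>) \<le> (SUP R\<in>C f \<alpha> \<omega>. ennreal (f N R / \<alpha>))"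
    using assms(3) by (rule SUP_upper)
  also have "\<dots> \<le> (SUP f\<in>F. SUP R\<in>C f \<alpha> \<omega>. ennreal (f N R / \<alpha>))"
    using assms(1) by (rule SUP_upper)
  also have "\<dots> \<le> sup_loss F C N \<omega>"
    unfolding sup_loss_def using assms(2) by (intro SUP_upper) simp
  finally show ?thesis .
qed

lemma less_sup_loss_iff:
  "c < sup_loss F C N \<omega> \<longleftrightarrow> (\<exists>\<alpha>>0. \<exists>f\<in>F. \<exists>R\<in>C f \<alpha> \<omega>. c < ennreal (f N R / \<alpha>))"
  by (auto simp: sup_loss_def less_SUP_iff)

lemma sup_loss_discovery_sets_le:
  assumes "N \<in> Pow {1..m}"
  shows "sup_loss F (discovery_sets m E) N \<omega> \<le> E N \<omega>"
  unfolding sup_loss_def using assms by (auto intro!: SUP_least simp: discovery_sets_def)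

text \<open>Continuity of \<open>x / \<beta>\<close> at \<open>\<alpha>\<close> preserves the strict
  inequality. The gap between \<open>\<alpha>\<close> and \<open>\<beta>\<close> is what leaves room
  for rational corners.\<close>

lemma ennreal_less_divide_enlarge:
  fixes x \<alpha> :: real
  assumes "c < ennreal (x / \<alpha>)" "\<alpha> > 0"
  obtains \<beta> where "\<beta> > \<alpha>" "c < ennreal (x / \<beta>)"
proof -
  \<comment> \<open>A value strictly below another cannot be infinite, so the comparison moves to
    the reals.\<close>
  obtain d where d: "0 \<le> d" "c = ennreal d"
    using assms(1) by (cases c) auto
  have "d < x / \<alpha>"
    using assms(1) d by (metis ennreal_less_iff)
  moreover have "((\<lambda>\<beta>. x / \<beta>) \<longlongrightarrow> x / \<alpha>) (at_right \<alpha>)"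
    using assms(2) by (auto intro!: tendsto_eq_intros)
  ultimately have "\<forall>\<^sub>F \<beta> in at_right \<alpha>. d < x / \<beta>"
    by (rule order_tendstoD(1)[rotated])
  moreover have "\<forall>\<^sub>F \<beta> in at_right \<alpha>. \<beta> > \<alpha>"
    by (rule eventually_at_right_less)
  ultimately have "\<forall>\<^sub>F \<beta> in at_right \<alpha>. d < x / \<beta> \<and> \<beta> > \<alpha>"
    by eventually_elim simp
  then obtain \<beta> where "d < x / \<beta>" "\<beta> > \<alpha>"
    using eventually_happens' trivial_limit_at_right_real by blast
  with d that show ?thesis
    by (auto simp: ennreal_less_iff)
qed

text \<open>Density of the rationals applies only if \<open>x > 0\<close>. For \<open>x = 0\<close>
  the quotients coincide, but at the rational number \<open>0\<close>, which is why the bounds are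
  not strict.\<close>

lemma exists_rational_between_quotients:
  fixes x \<alpha> \<beta> :: real
  assumes "0 \<le> x" "0 < \<alpha>" "\<alpha> < \<beta>"
  shows "\<exists>q\<in>\<rat>. x / \<beta> \<le> q \<and> q \<le> x / \<alpha>"
proof (cases "x = 0")
  case False
  with assms have "x / \<beta> < x / \<alpha>"
    by (simp add: divide_strict_left_mono)
  then show ?thesis
    using Rats_dense_in_real[of "x / \<beta>" "x / \<alpha>"] by (meson less_imp_le)
qed auto

lemma borel_measurable_sup_loss_discovery_sets:
  assumes E: "\<And>S. S \<in> Pow {1..m} \<Longrightarrow> E S \<in> borel_measurable A"
    and F: "\<And>f. f \<in> F \<Longrightarrow> error_function m f"
  shows "sup_loss F (discovery_sets m E) N \<in> borel_measurable A"
proof (rule borel_measurableI_greater)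
  fix c :: ennreal
  \<comment> \<open>A corner \<open>q\<close> in \<open>Q\<close> dominates some loss vector
    \<open>f S R / \<beta>\<close> with \<open>f N R / \<beta>\<close> above \<open>c\<close>. Its
    entries are rational and it is extensional on a finite set, so \<open>Q\<close> is countable
    however large \<open>F\<close> is.\<close>
  define Q where "Q = {q \<in> Pow {1..m} \<rightarrow>\<^sub>E \<rat>. \<exists>\<beta>>0. \<exists>f\<in>F. \<exists>R\<in>Pow {1..m}.
    c < ennreal (f N R / \<beta>) \<and> (\<forall>S\<in>Pow {1..m}. f S R / \<beta> \<le> q S)}"
  have "countable (Pow {1..m} \<rightarrow>\<^sub>E (\<rat> :: real set))"
    by (intro countable_PiE) (auto simp: countable_rat)
  then have "countable Q"
    by (rule countable_subset[rotated]) (auto simp: Q_def)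
  have "c < sup_loss F (discovery_sets m E) N \<omega> \<longleftrightarrow>
      (\<exists>q\<in>Q. \<forall>S\<in>Pow {1..m}. ennreal (q S) \<le> E S \<omega>)" for \<omega>
  proof
    assume "c < sup_loss F (discovery_sets m E) N \<omega>"
    then obtain \<alpha> f R where \<alpha>: "\<alpha> > 0" and f: "f \<in> F"
      and R: "R \<in> discovery_sets m E f \<alpha> \<omega>" and c: "c < ennreal (f N R / \<alpha>)"
      unfolding less_sup_loss_iff by blast
    have R': "R \<in> Pow {1..m}" "\<And>S. S \<in> Pow {1..m} \<Longrightarrow> ennreal (f S R / \<alpha>) \<le> E S \<omega>"
      using R by (auto simp: discovery_sets_def)
    obtain \<beta> where \<beta>: "\<beta> > \<alpha>" "c < ennreal (f N R / \<beta>)"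
      using ennreal_less_divide_enlarge[OF c \<alpha>] .
    \<comment> \<open>The same \<open>\<beta>\<close> serves every \<open>S\<close>. The lower
      bounds place the corner in \<open>Q\<close>, the upper bounds place it below the vector of the
      \<open>E S \<omega>\<close>.\<close>
    have "\<forall>S\<in>Pow {1..m}. \<exists>q\<in>\<rat>. f S R / \<beta> \<le> q \<and> q \<le> f S R / \<alpha>"
      using F[OF f] R'(1) \<alpha> \<beta>(1)
      by (intro ballI exists_rational_between_quotients) (auto simp: error_function_def)
    then obtain q where q: "\<forall>S\<in>Pow {1..m}. q S \<in> \<rat> \<and> f S R / \<beta> \<le> q S \<and> q S \<le> f S R / \<alpha>"
      by metis
    have "restrict q (Pow {1..m}) \<in> Q"
      unfolding Q_def
    proof (intro CollectI conjI)
      show "\<exists>\<beta>>0. \<exists>f\<in>F. \<exists>R\<in>Pow {1..m}. c < ennreal (f N R / \<beta>) \<and>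
          (\<forall>S\<in>Pow {1..m}. f S R / \<beta> \<le> restrict q (Pow {1..m}) S)"
        using q \<alpha> \<beta> f R'(1) by (intro exI[of _ \<beta>] conjI bexI[of _ f] bexI[of _ R]) auto
    qed (use q in simp)
    moreover have "\<forall>S\<in>Pow {1..m}. ennreal (restrict q (Pow {1..m}) S) \<le> E S \<omega>"
    proof
      fix S assume S: "S \<in> Pow {1..m}"
      then have "ennreal (restrict q (Pow {1..m}) S) \<le> ennreal (f S R / \<alpha>)"
        using q by (simp add: ennreal_leI)
      also have "\<dots> \<le> E S \<omega>"
        using S by (rule R'(2))
      finally show "ennreal (restrict q (Pow {1..m}) S) \<le> E S \<omega>" .
    qed
    ultimately show "\<exists>q\<in>Q. \<forall>S\<in>Pow {1..m}. ennreal (q S) \<le> E S \<omega>"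
      by blast
  next
    assume "\<exists>q\<in>Q. \<forall>S\<in>Pow {1..m}. ennreal (q S) \<le> E S \<omega>"
    then obtain q where "q \<in> Q" and q: "\<forall>S\<in>Pow {1..m}. ennreal (q S) \<le> E S \<omega>"
      by (elim bexE)
    from \<open>q \<in> Q\<close> obtain \<beta> f R
      where \<beta>: "\<beta> > 0" "f \<in> F" "R \<in> Pow {1..m}" "c < ennreal (f N R / \<beta>)"
      and le: "\<forall>S\<in>Pow {1..m}. f S R / \<beta> \<le> q S"
      unfolding Q_def by (elim CollectE conjE exE bexE)
    \<comment> \<open>Whatever loss and level witness \<open>q \<in> Q\<close>, their set
      \<open>R\<close> is a discovery set at that level \<open>\<beta>\<close>, because
      \<open>E\<close> dominates \<open>q\<close> and \<open>q\<close> dominates the losses.\<close>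
    have "ennreal (f S R / \<beta>) \<le> E S \<omega>" if "S \<in> Pow {1..m}" for S
      using order_trans[OF ennreal_leI[OF bspec[OF le that]] bspec[OF q that]] .
    then have "R \<in> discovery_sets m E f \<beta> \<omega>"
      using \<beta>(3) by (simp add: discovery_sets_def)
    then show "c < sup_loss F (discovery_sets m E) N \<omega>"
      unfolding less_sup_loss_iff using \<beta> by blast
  qed
  then have "{\<omega> \<in> space A. c < sup_loss F (discovery_sets m E) N \<omega>} =
      (\<Union>q\<in>Q. {\<omega> \<in> space A. \<forall>S\<in>Pow {1..m}. ennreal (q S) \<le> E S \<omega>})"
    by blast
  also have "\<dots> \<in> sets A"
  proof (rule sets.countable_UN''[OF \<open>countable Q\<close>])
    show "{\<omega> \<in> space A. \<forall>S\<in>Pow {1..m}. ennreal (q S) \<le> E S \<omega>} \<in> sets A" for q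
      using E by measurable
  qed
  finally show "{\<omega> \<in> space A. c < sup_loss F (discovery_sets m E) N \<omega>} \<in> sets A" .
qed

lemma simultaneous_control_discovery_sets:
  assumes E: "e_collection A M m H E"
    and F: "\<And>f. f \<in> F \<Longrightarrow> error_function m f"
  shows "simultaneous_control A M m H F (discovery_sets m E)"
proof -
  have meas: "\<And>S. S \<in> Pow {1..m} \<Longrightarrow> E S \<in> borel_measurable A"
    using E by (auto simp: e_collection_def)
  have "(\<integral>\<^sup>+\<omega>. sup_loss F (discovery_sets m E) (true_hyps m H P) \<omega> \<partial>P) \<le> 1" if "P \<in> M" for P
  proof -
    have "(\<integral>\<^sup>+\<omega>. sup_loss F (discovery_sets m E) (true_hyps m H P) \<omega> \<partial>P) \<le>
        (\<integral>\<^sup>+\<omega>. E (true_hyps m H P) \<omega> \<partial>P)"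
      by (intro nn_integral_mono sup_loss_discovery_sets_le true_hyps_in_Pow)
    also have "\<dots> \<le> 1"
      using E that by (auto simp: e_collection_def)
    finally show ?thesis .
  qed
  then show ?thesis
    unfolding simultaneous_control_def
    by (intro conjI ballI allI impI measurable_discovery_sets meas
        borel_measurable_sup_loss_discovery_sets F)
qed

text \<open>For index sets that no \<open>P\<close> realises, control does not even give
  measurability of the supremum; the constant \<open>\<infinity>\<close> is measurable and makes the
  required inequality trivial. The empty set is tested first, to respect the convention for
  e-collections.\<close>

definition sup_loss_e_collection ::
  "'a measure set \<Rightarrow> nat \<Rightarrow> (nat \<Rightarrow> 'a measure set) \<Rightarrow> (nat set \<Rightarrow> nat set \<Rightarrow> real) set \<Rightarrow>
     ((nat set \<Rightarrow> nat set \<Rightarrow> real) \<Rightarrow> real \<Rightarrow> 'a \<Rightarrow> nat set set) \<Rightarrow> nat set \<Rightarrow> 'a \<Rightarrow> ennreal" where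
  "sup_loss_e_collection M m H F C S \<omega> =
     (if S = {} then 0 else if S \<in> true_hyps m H ` M then sup_loss F C S \<omega> else \<infinity>)"

lemma e_collection_sup_loss_e_collection:
  assumes "simultaneous_control A M m H F C"
  shows "e_collection A M m H (sup_loss_e_collection M m H F C)"
proof -
  \<comment> \<open>For a realised nonempty \<open>S\<close>, measurability is part of simultaneous
    control; otherwise the function is constant.\<close>
  have "sup_loss_e_collection M m H F C S \<in> borel_measurable A" for S
  proof (cases "S \<noteq> {} \<and> S \<in> true_hyps m H ` M")
    case True
    then have "sup_loss_e_collection M m H F C S = sup_loss F C S"
      by (simp add: sup_loss_e_collection_def fun_eq_iff)
    with True assms show ?thesis
      unfolding simultaneous_control_def by force
  next
    case False
    then have "sup_loss_e_collection M m H F C S = (\<lambda>_. if S = {} then 0 else \<infinity>)"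
      by (auto simp add: sup_loss_e_collection_def fun_eq_iff)
    then show ?thesis
      by simp
  qed
  moreover have "(\<integral>\<^sup>+\<omega>. sup_loss_e_collection M m H F C (true_hyps m H P) \<omega> \<partial>P) \<le> 1"
    if "P \<in> M" for P
    using assms that by (cases "true_hyps m H P = {}")
      (auto simp: sup_loss_e_collection_def simultaneous_control_def)
  ultimately show ?thesis
    by (auto simp: e_collection_def sup_loss_e_collection_def)
qed

text \<open>The loss ratio of any \<open>R\<close> in the collection is one of the terms of the
  supremum.\<close>

lemma subset_discovery_sets_sup_loss_e_collection:
  assumes C: "simultaneous_control A M m H F C"
    and f: "f \<in> F" "error_function m f" and "\<alpha> > 0" and "\<omega> \<in> space A"
  shows "C f \<alpha> \<omega> \<subseteq> discovery_sets m (sup_loss_e_collection M m H F C) f \<alpha> \<omega>"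
proof
  fix R assume R: "R \<in> C f \<alpha> \<omega>"
  \<comment> \<open>Measurability serves here through its codomain: the members of
    \<open>C f \<alpha> \<omega>\<close> are subsets of \<open>{1..m}\<close>.\<close>
  have "C f \<alpha> \<in> measurable A (count_space (Pow (Pow {1..m})))"
    using C f(1) \<open>\<alpha> > 0\<close> by (auto simp: simultaneous_control_def)
  then have "C f \<alpha> \<omega> \<in> Pow (Pow {1..m})"
    using measurable_space[OF _ \<open>\<omega> \<in> space A\<close>] by (metis space_count_space)
  with R have "R \<in> Pow {1..m}"
    by blast
  \<comment> \<open>This settles the case \<open>S = {}\<close>, where the e-value is
    \<open>0\<close>.\<close>
  with f(2) have "f {} R = 0"
    by (auto simp: error_function_def)
  then have "ennreal (f S R / \<alpha>) \<le> sup_loss_e_collection M m H F C S \<omega>" for S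
    using sup_loss_upper[where C = C, OF f(1) \<open>\<alpha> > 0\<close> R] by (simp add: sup_loss_e_collection_def)
  then show "R \<in> discovery_sets m (sup_loss_e_collection M m H F C) f \<alpha> \<omega>"
    using \<open>R \<in> Pow {1..m}\<close> by (simp add: discovery_sets_def)
qed

theorem theorem48:
  fixes A :: "'a measure" and M :: "'a measure set"
    and m :: nat and H :: "nat \<Rightarrow> 'a measure set"
    and F :: "(nat set \<Rightarrow> nat set \<Rightarrow> real) set"
  assumes "\<And>P. P \<in> M \<Longrightarrow> prob_space P \<and> sets P = sets A"
    and "\<And>i. i \<in> {1..m} \<Longrightarrow> H i \<subseteq> M"
    and "\<And>f. f \<in> F \<Longrightarrow> error_function m f"
  shows "(\<forall>E. e_collection A M m H E \<longrightarrow> simultaneous_control A M m H F (discovery_sets m E)) \<and>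
    (\<forall>C. simultaneous_control A M m H F C \<longrightarrow>
      (\<exists>E. e_collection A M m H E \<and>
        (\<forall>P\<in>M. AE \<omega> in P. \<forall>f\<in>F. \<forall>\<alpha>>0. C f \<alpha> \<omega> \<subseteq> discovery_sets m E f \<alpha> \<omega>)))"
proof (intro conjI allI impI)
  fix E assume "e_collection A M m H E"
  then show "simultaneous_control A M m H F (discovery_sets m E)"
    using assms(3) by (rule simultaneous_control_discovery_sets)
next
  fix C assume C: "simultaneous_control A M m H F C"
  have "AE \<omega> in P. \<forall>f\<in>F. \<forall>\<alpha>>0.
      C f \<alpha> \<omega> \<subseteq> discovery_sets m (sup_loss_e_collection M m H F C) f \<alpha> \<omega>" if "P \<in> M" for P
  \<comment> \<open>The inclusion holds at every point, so no union of null sets over uncountably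
    many \<open>f\<close> and \<open>\<alpha>\<close> arises.\<close>
  proof (intro AE_I2 ballI allI impI)
    fix \<omega> f and \<alpha> :: real assume "\<omega> \<in> space P" "f \<in> F" "\<alpha> > 0"
    moreover have "space P = space A"
      using assms(1)[OF that] sets_eq_imp_space_eq by blast
    ultimately show "C f \<alpha> \<omega> \<subseteq> discovery_sets m (sup_loss_e_collection M m H F C) f \<alpha> \<omega>"
      using subset_discovery_sets_sup_loss_e_collection[OF C] assms(3) by blast
  qed
  then show "\<exists>E. e_collection A M m H E \<and>
      (\<forall>P\<in>M. AE \<omega> in P. \<forall>f\<in>F. \<forall>\<alpha>>0. C f \<alpha> \<omega> \<subseteq> discovery_sets m E f \<alpha> \<omega>)"
    using e_collection_sup_loss_e_collection[OF C] by blast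
qed

end
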